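(* Let $n\ge 1$ and let $m=(m_0,m_1,\dots,m_n)$ be a sequence of non-negative integers. Define the $(m_0+1)\times(m_n+1)$ matrix \[ M_m := R_{m_0,m_0}R_{m_0,m_1}R_{m_1,m_2}\cdots R_{m_{n-1},m_n}. \] Then for all $1\le i\le m_0+1$ and $1\le j\le m_n+1$, the $(i,j)$-entry of $M_m$ equals $\left|\Omega^{ij}_{\mathbf{n}_m}(\mathcal{G}^s_n)\right|$. In particular, the $(1,1)$-entry of $M_m$ equals $\left|\Omega_{\mathbf{n}_m}(\mathcal{G}^s_n)\right|$.
   Context: Mixed dimer covers: for a finite graph $\mathcal{G}=(V,E)$ and a function $\mathbf{n}\colon V\to\mathbb{N}$, an $\mathbf{n}$-dimer cover is a function $\mathbf{m}\colon E\to\mathbb{N}$ (edge multiplicities) such that $\sum_{e\ni v}\mathbf{m}(e)=\mathbf{n}(v)$ for every vertex $v$; the set of these is $\Omega_{\mathbf{n}}(\mathcal{G})$. The straight snake graph $\mathcal{G}^s_n$ is the $2\times(n+1)$ grid graph with bottom vertices $v_{1,0},\dots,v_{1,n}$ and top vertices $v_{2,0},\dots,v_{2,n}$, with vertical edges $v_{1,k}v_{2,k}$ ($0\le k\le n$) and horizontal edges $v_{r,k-1}v_{r,k}$ ($r=1,2$, $1\le k\le n$). For a sequence $x=(x_0,\dots,x_n)$ of non-negative integers, $\mathbf{n}_x$ is the vertex labeling with $\mathbf{n}_x(v_{1,k})=\mathbf{n}_x(v_{2,k})=x_k$. For $m=(m_0,\dots,m_n)$, $\Omega^{ij}_{\mathbf{n}_m}(\mathcal{G}^s_n):=\Omega_{\mathbf{n}_{m'}}(\mathcal{G}^s_n)$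 where $m'=(m_0+1-i,m_1,m_2,\dots,m_{n-1},m_n+1-j)$ (empty if an entry is negative). For non-negative integers $a,b$, $R_{a,b}$ is the $(a+1)\times(b+1)$ matrix whose $(i,j)$-entry is $1$ if $i+j\le b+2$ and $0$ otherwise. *)

theory Defs
  imports "Jordan_Normal_Form.Matrix"
begin

text \<open>A graph is a pair of its vertex set and its edge set, an edge being the set of its two endpoints.\<close>

type_synonym 'v graph = "'v set \<times> 'v set set"

definition finite_graph :: "'v graph \<Rightarrow> bool" where
  "finite_graph G \<longleftrightarrow> finite (fst G) \<and> (\<forall>e\<in>snd G. e \<subseteq> fst G \<and> card e = 2)"

text \<open>
  The functions from edges to natural numbers are taken in the extensional function space, so that
  distinct elements of \<open>dimer_covers\<close> differ on some edge.
\<close>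

definition dimer_covers :: "'v graph \<Rightarrow> ('v \<Rightarrow> nat) \<Rightarrow> ('v set \<Rightarrow> nat) set" where
  "dimer_covers G l =
     {c \<in> snd G \<rightarrow>\<^sub>E UNIV. \<forall>v\<in>fst G. (\<Sum>e | e \<in> snd G \<and> v \<in> e. c e) = l v}"

text \<open>The vertex \<open>v\<^bsub>r,k\<^esub>\<close> is the pair \<open>(r, k)\<close>; row 1 is the bottom row and row 2 the top row.\<close>

definition straight_snake :: "nat \<Rightarrow> (nat \<times> nat) graph" where
  "straight_snake n =
     ({1, 2} \<times> {0..n},
      {{(1, k), (2, k)} | k. k \<le> n} \<union>
      {{(r, k - 1), (r, k)} | r k. r \<in> {1, 2} \<and> 1 \<le> k \<and> k \<le> n})"

text \<open>
  A sequence \<open>x\<^sub>0, \<dots>, x\<^sub>n\<close> is represented by a function of which only the values at \<open>0, \<dots>, n\<close> matter.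
\<close>

definition column_label :: "(nat \<Rightarrow> nat) \<Rightarrow> nat \<times> nat \<Rightarrow> nat" where
  "column_label x = (\<lambda>(r, k). x k)"

text \<open>
  The guard says that both modified entries are nonnegative, so no subtraction is truncated.
  The definition is meant for \<open>n \<ge> 1\<close>, where the two updated positions differ.
\<close>

definition snake_covers_ij ::
    "nat \<Rightarrow> (nat \<Rightarrow> nat) \<Rightarrow> nat \<Rightarrow> nat \<Rightarrow> ((nat \<times> nat) set \<Rightarrow> nat) set" where
  "snake_covers_ij n m i j =
     (if i \<le> m 0 + 1 \<and> j \<le> m n + 1
      then dimer_covers (straight_snake n)
             (column_label (m(0 := m 0 + 1 - i, n := m n + 1 - j)))
      else {})"

text \<open>Matrix indices start at 0 in the library, hence the shifts by 1 in the defining condition.\<close>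

definition R_mat :: "nat \<Rightarrow> nat \<Rightarrow> int mat" where
  "R_mat a b = mat (a + 1) (b + 1) (\<lambda>(i, j). if (i + 1) + (j + 1) \<le> b + 2 then 1 else 0)"

primrec M_mat :: "(nat \<Rightarrow> nat) \<Rightarrow> nat \<Rightarrow> int mat" where
  "M_mat m 0 = R_mat (m 0) (m 0)"
| "M_mat m (Suc n) = M_mat m n * R_mat (m n) (m (Suc n))"

lemma M_mat_carrier: "M_mat m n \<in> carrier_mat (m 0 + 1) (m n + 1)"
  by (induction n) (auto simp: R_mat_def)

lemma finite_graph_straight_snake: "finite_graph (straight_snake n)"
  by (auto simp: finite_graph_def straight_snake_def card_insert_if)

text \<open>Finiteness ensures that \<open>card\<close> is the true number of dimer covers.\<close>

lemma finite_dimer_covers: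
  assumes "finite_graph G"
  shows "finite (dimer_covers G l)"
proof -
  have finE: "finite (snd G)"
    by (rule finite_subset[of _ "Pow (fst G)"]) (use assms in \<open>auto simp: finite_graph_def\<close>)
  have "dimer_covers G l \<subseteq> (snd G \<rightarrow>\<^sub>E {..(\<Sum>v\<in>fst G. l v)})"
  proof
    fix c assume c: "c \<in> dimer_covers G l"
    have "c e \<le> (\<Sum>v\<in>fst G. l v)" if e: "e \<in> snd G" for e
    proof -
      from e assms have "e \<noteq> {}" "e \<subseteq> fst G" by (auto simp: finite_graph_def)
      then obtain v where v: "v \<in> e" "v \<in> fst G" by auto
      have "c e \<le> (\<Sum>e | e \<in> snd G \<and> v \<in> e. c e)"
        by (rule member_le_sum) (use e v finE in auto)
      also have "\<dots> = l v" using c v by (auto simp: dimer_covers_def)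
      also have "\<dots> \<le> (\<Sum>v\<in>fst G. l v)"
        by (rule member_le_sum) (use v assms in \<open>auto simp: finite_graph_def\<close>)
      finally show ?thesis .
    qed
    with c show "c \<in> (snd G \<rightarrow>\<^sub>E {..(\<Sum>v\<in>fst G. l v)})"
      by (auto simp: dimer_covers_def PiE_iff)
  qed
  then show ?thesis
    by (rule finite_subset) (simp add: finE finite_PiE)
qed

end

theory Submission imports Defs begin

text \<open>
  Going through the columns from left to right shows that in a dimer cover of the snake with row
  independent labels the two horizontal edges between consecutive columns have the same
  multiplicity. Hence the cover amounts to the sequence \<open>h 1, \<dots>, h n\<close> of these multiplicities,
  subject to \<open>h k + h (k + 1) \<le> x k\<close> where \<open>h 0 = h (n + 1) = 0\<close>, the slack being the multiplicity
  of the vertical edge. An entry of the product of the matrices \<open>R\<close> counts the same sequences with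
  boundary values \<open>h 0 = i\<close>, \<open>h (n + 1) = j\<close>, and a boundary value can be traded for a decrease of
  the outer labels.
\<close>

section \<open>Sequences with bounded adjacent sums and the product of the \<open>R_mat\<close>
  matrices\<close>

definition bounded_seqs :: "(nat \<Rightarrow> nat) \<Rightarrow> nat \<Rightarrow> nat \<Rightarrow> nat \<Rightarrow> (nat \<Rightarrow> nat) set" where
  "bounded_seqs x n i j =
     {h. h 0 = i \<and> h (Suc n) = j \<and> (\<forall>k>Suc n. h k = 0) \<and> (\<forall>k\<le>n. h k + h (Suc k) \<le> x k)}"

text \<open>Positions up to \<open>n\<close> are bounded by their own label, position
  \<open>Suc n\<close> by \<open>j\<close>, and the prescribed zero tail leaves only finitely many
  values free.\<close>

lemma finite_bounded_seqs: "finite (bounded_seqs x n i j)"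
proof -
  define B where "B = j + (\<Sum>k\<le>n. x k)"
  have le: "h k \<le> B" if "h \<in> bounded_seqs x n i j" "k \<le> Suc n" for h k
  proof (cases "k \<le> n")
    case True
    then have "h k \<le> x k" using that by (force simp: bounded_seqs_def)
    also have "\<dots> \<le> (\<Sum>k\<le>n. x k)" using True by (intro member_le_sum) auto
    finally show ?thesis by (simp add: B_def)
  qed (use that in \<open>auto simp: bounded_seqs_def B_def le_Suc_eq\<close>)
  have "bounded_seqs x n i j \<subseteq> 
      {h. \<forall>k. (k \<in> {..Suc n} \<longrightarrow> h k \<in> {..B}) \<and> (k \<notin> {..Suc n} \<longrightarrow> h k = 0)}"
    using le by (auto simp: bounded_seqs_def)
  then show ?thesis
    by (rule finite_subset) (intro finite_set_of_finite_funs finite_atMost)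
qed

lemma bounded_seqs_0:
  "bounded_seqs x 0 i j = (if i + j \<le> x 0 then {(\<lambda>_. 0)(0 := i, Suc 0 := j)} else {})"
proof -
  let ?f = "(\<lambda>_. 0)(0 := i, Suc 0 := j)"
  have eq: "h = ?f" if "h \<in> bounded_seqs x 0 i j" for h
  proof
    fix k
    consider "k = 0" | "k = Suc 0" | "k > Suc 0" by linarith
    then show "h k = ?f k"
      using that by cases (simp_all add: bounded_seqs_def)
  qed
  show ?thesis
  proof (cases "i + j \<le> x 0")
    case True
    then have "?f \<in> bounded_seqs x 0 i j" by (simp add: bounded_seqs_def)
    then have "bounded_seqs x 0 i j = {?f}" using eq by blast
    then show ?thesis using True by (simp only: if_True)
  next
    case False
    then have "bounded_seqs x 0 i j = {}" by (auto simp: bounded_seqs_def)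
    then show ?thesis using False by (simp only: if_False)
  qed
qed

text \<open>The pieces are sorted by the value \<open>p\<close> at position \<open>Suc n\<close>,
  which becomes the right boundary value of a shorter sequence. The bound
  \<open>p \<le> x n\<close>, forced whenever the piece is nonempty, matches the column range of
  \<open>M_mat\<close>.\<close>

lemma bounded_seqs_Suc:
  "bounded_seqs x (Suc n) i j =
     (\<Union>p\<in>{p. p \<le> x n \<and> p + j \<le> x (Suc n)}. (\<lambda>h. h(Suc (Suc n) := j)) ` bounded_seqs x n i p)"
    (is "?L = ?R")
proof
  show "?L \<subseteq> ?R"
  proof
    fix h assume h: "h \<in> ?L"
    \<comment> \<open>The old boundary value is cleared because the shorter sequences vanish beyond
      \<open>Suc n\<close>.\<close>
    let ?g = "h(Suc (Suc n) := 0)"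
    have "?g \<in> bounded_seqs x n i (h (Suc n))"
      using h by (auto simp: bounded_seqs_def)
    moreover have "h = ?g(Suc (Suc n) := j)"
      using h by (auto simp: bounded_seqs_def)
    moreover have "h n + h (Suc n) \<le> x n" "h (Suc n) + j \<le> x (Suc n)"
      using h unfolding bounded_seqs_def by fastforce+
    ultimately show "h \<in> ?R" by (intro UN_I[of "h (Suc n)"] CollectI image_eqI[of h _ ?g]) simp_all
  qed
  show "?R \<subseteq> ?L" by (auto simp: bounded_seqs_def le_Suc_eq)
qed

lemma card_bounded_seqs_Suc:
  "card (bounded_seqs x (Suc n) i j) =
     (\<Sum>p | p \<le> x n \<and> p + j \<le> x (Suc n). card (bounded_seqs x n i p))"
proof -
  let ?u = "\<lambda>h::nat \<Rightarrow> nat. h(Suc (Suc n) := j)"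
  \<comment> \<open>The overwritten position holds 0 in every member, so overwriting it loses
    nothing.\<close>
  have inj: "inj_on ?u (bounded_seqs x n i p)" for p
  proof (rule inj_onI)
    fix g h assume *: "g \<in> bounded_seqs x n i p" "h \<in> bounded_seqs x n i p" "?u g = ?u h"
    have "g k = h k" for k
      using *(1,2) fun_cong[OF *(3), of k] by (cases "k = Suc (Suc n)") (simp_all add: bounded_seqs_def)
    then show "g = h" ..
  qed
  \<comment> \<open>The update leaves position \<open>Suc n\<close> alone, so \<open>p\<close> can
    be read off from the image.\<close>
  have disj: "?u ` bounded_seqs x n i p \<inter> ?u ` bounded_seqs x n i q = {}" if "p \<noteq> q" for p q
  proof -
    have "f (Suc n) = p" if "f \<in> ?u ` bounded_seqs x n i p" for f p
      using that by (auto simp: bounded_seqs_def)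
    with \<open>p \<noteq> q\<close> show ?thesis by blast
  qed
  show ?thesis
    unfolding bounded_seqs_Suc
    by (subst card_UN_disjoint)
      (auto simp: finite_bounded_seqs disj card_image[OF inj])
qed

text \<open>With indices from 0, an entry of \<open>R_mat a b\<close> tests
  \<open>i + j \<le> b\<close>. Thus the first factor imposes the constraint at column 0, and the
  factor \<open>R_mat (m k) (m (Suc k))\<close> the one at column \<open>Suc k\<close>.
  Multiplication sums over the sequence value shared by two neighbouring constraints, hence the
  induction with \<open>j\<close> arbitrary.\<close>

lemma M_mat_entry:
  assumes "i \<le> m 0" "j \<le> m n"
  shows "M_mat m n $$ (i, j) = int (card (bounded_seqs m n i j))"
  using assms(2)
proof (induction n arbitrary: j)
  case 0
  with assms(1) show ?case by (simp add: R_mat_def bounded_seqs_0)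
next
  case (Suc n)
  have dim: "dim_row (M_mat m n) = m 0 + 1" "dim_col (M_mat m n) = m n + 1"
    using M_mat_carrier[of m n] by auto
  have "M_mat m (Suc n) $$ (i, j) =
      (\<Sum>p = 0..<m n + 1. M_mat m n $$ (i, p) * R_mat (m n) (m (Suc n)) $$ (p, j))"
    using assms(1) Suc.prems dim
    by (simp add: scalar_prod_def R_mat_def)
  also have "\<dots> = (\<Sum>p = 0..<m n + 1. if p + j \<le> m (Suc n) then int (card (bounded_seqs m n i p)) else 0)"
    using Suc by (intro sum.cong) (auto simp: R_mat_def)
  also have "\<dots> = (\<Sum>p | p \<le> m n \<and> p + j \<le> m (Suc n). int (card (bounded_seqs m n i p)))"
    by (subst sum.inter_filter [symmetric]) (auto intro!: sum.cong)
  finally show ?case by (simp add: card_bounded_seqs_Suc)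
qed

text \<open>\<open>h 0\<close> enters only the constraint at 0 and \<open>h (Suc n)\<close> only the
  one at \<open>n\<close>, so both can be moved to the right-hand side. \<open>n \<ge> 1\<close>
  keeps the two updated labels apart.\<close>

lemma card_bounded_seqs_boundary:
  assumes "n \<ge> 1" "i \<le> m 0" "j \<le> m n"
  shows "card (bounded_seqs m n i j) = card (bounded_seqs (m(0 := m 0 - i, n := m n - j)) n 0 0)"
proof (rule bij_betw_same_card)
  let ?x = "m(0 := m 0 - i, n := m n - j)"
  show "bij_betw (\<lambda>h. h(0 := 0, Suc n := 0)) (bounded_seqs m n i j) (bounded_seqs ?x n 0 0)"
  proof (rule bij_betw_byWitness[where f' = "\<lambda>h. h(0 := i, Suc n := j)"])
    show "(\<lambda>h. h(0 := 0, Suc n := 0)) ` bounded_seqs m n i j \<subseteq> bounded_seqs ?x n 0 0"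
    proof safe
      fix h assume "h \<in> bounded_seqs m n i j"
      then have h: "h 0 = i" "h (Suc n) = j" "\<And>k. k > Suc n \<Longrightarrow> h k = 0"
        "\<And>k. k \<le> n \<Longrightarrow> h k + h (Suc k) \<le> m k"
        by (auto simp: bounded_seqs_def)
      have "(h(0 := 0, Suc n := 0)) k + (h(0 := 0, Suc n := 0)) (Suc k) \<le> ?x k" if "k \<le> n" for k
        using h(1,2) h(4)[OF that] assms that by auto
      with h(3) show "h(0 := 0, Suc n := 0) \<in> bounded_seqs ?x n 0 0"
        by (simp add: bounded_seqs_def)
    qed
    show "(\<lambda>h. h(0 := i, Suc n := j)) ` bounded_seqs ?x n 0 0 \<subseteq> bounded_seqs m n i j"
    proof safe
      fix h assume "h \<in> bounded_seqs ?x n 0 0"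
      then have h: "h 0 = 0" "h (Suc n) = 0" "\<And>k. k > Suc n \<Longrightarrow> h k = 0"
        "\<And>k. k \<le> n \<Longrightarrow> h k + h (Suc k) \<le> ?x k"
        by (auto simp: bounded_seqs_def)
      have "(h(0 := i, Suc n := j)) k + (h(0 := i, Suc n := j)) (Suc k) \<le> m k" if "k \<le> n" for k
        using h(1,2) h(4)[OF that] assms that by (auto split: if_splits)
      with h show "h(0 := i, Suc n := j) \<in> bounded_seqs m n i j"
        by (auto simp: bounded_seqs_def)
    qed
  qed (auto simp: bounded_seqs_def)
qed

section \<open>Edges of the snake and their incidence with the vertices\<close>

abbreviation vertical :: "nat \<Rightarrow> (nat \<times> nat) set" where
  "vertical k \<equiv> {(1, k), (2, k)}"

abbreviation horizontal :: "nat \<Rightarrow> nat \<Rightarrow> (nat \<times> nat) set" where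
  "horizontal r k \<equiv> {(r, k - 1), (r, k)}"

lemma mem_straight_snake_edges_iff:
  "e \<in> snd (straight_snake n) \<longleftrightarrow>
     (\<exists>k. k \<le> n \<and> e = vertical k) \<or> (\<exists>r k. r \<in> {1, 2} \<and> 1 \<le> k \<and> k \<le> n \<and> e = horizontal r k)"
  unfolding straight_snake_def snd_conv Un_iff mem_Collect_eq
  by (intro arg_cong2[where f = "(\<or>)"] ex_cong1 conj_commute) (simp only: conj_ac)

lemma vertical_mem: "k \<le> n \<Longrightarrow> vertical k \<in> snd (straight_snake n)"
  unfolding mem_straight_snake_edges_iff by (rule disjI1, rule exI[of _ k]) simp

lemma horizontal_mem:
  "r \<in> {1, 2} \<Longrightarrow> 1 \<le> k \<Longrightarrow> k \<le> n \<Longrightarrow> horizontal r k \<in> snd (straight_snake n)"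
  unfolding mem_straight_snake_edges_iff by (rule disjI2, rule exI[of _ r], rule exI[of _ k]) simp

lemma straight_snake_edge_cases:
  assumes "e \<in> snd (straight_snake n)"
  obtains k where "k \<le> n" "e = vertical k"
    | r k where "r \<in> {1, 2}" "1 \<le> k" "k \<le> n" "e = horizontal r k"
  using assms unfolding mem_straight_snake_edges_iff by (elim disjE exE conjE)

lemma sum_incident:
  fixes c :: "(nat \<times> nat) set \<Rightarrow> nat"
  assumes "r \<in> {1, 2}" "k \<le> n"
  shows "(\<Sum>e | e \<in> snd (straight_snake n) \<and> (r, k) \<in> e. c e) =
    c (vertical k) + (if k \<ge> 1 then c (horizontal r k) else 0)
      + (if k < n then c (horizontal r (Suc k)) else 0)"
proof -
  have sum: "sum c (insert v ((if P then {a} else {}) \<union> (if Q then {b} else {}))) =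
      c v + (if P then c a else 0) + (if Q then c b else 0)"
    if "v \<noteq> a" "v \<noteq> b" "a \<noteq> b" for v a b P Q
    using that by auto
  have "{e. e \<in> snd (straight_snake n) \<and> (r, k) \<in> e} =
      insert (vertical k) ((if k \<ge> 1 then {horizontal r k} else {})
        \<union> (if k < n then {horizontal r (Suc k)} else {}))"
    (is "?L = ?R")
  proof
    show "?L \<subseteq> ?R"
    proof
      fix e assume "e \<in> ?L"
      then have e: "e \<in> snd (straight_snake n)" and mem: "(r, k) \<in> e" by simp_all
      from e show "e \<in> ?R"
      proof (cases rule: straight_snake_edge_cases)
        case (1 l)
        with mem have "l = k" by auto
        with 1 show ?thesis by blast
      next
        case (2 s l)
        with mem consider "s = r" "l = k" | "s = r" "l = Suc k" by auto
        then show ?thesis using 2 by cases simp_all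
      qed
    qed
    show "?R \<subseteq> ?L"
      using assms vertical_mem[of k n] horizontal_mem[of r k n] horizontal_mem[of r "Suc k" n]
      by (simp split: if_split) blast
  qed
  \<comment> \<open>The two inequalities also cover index 0, where truncated subtraction turns
    \<open>horizontal r 0\<close> into a singleton.\<close>
  moreover have "vertical k \<noteq> horizontal r l" for l
    using assms(1) by (auto simp: doubleton_eq_iff)
  moreover have "horizontal r k \<noteq> horizontal r (Suc k)"
    by (auto simp: doubleton_eq_iff)
  ultimately show ?thesis by (simp only: sum not_False_eq_True)
qed

section \<open>The correspondence between dimer covers and sequences\<close>

definition column_seq :: "nat \<Rightarrow> ((nat \<times> nat) set \<Rightarrow> nat) \<Rightarrow> nat \<Rightarrow> nat" where
  "column_seq n c k = (if 1 \<le> k \<and> k \<le> n then c (horizontal 1 k) else 0)"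

text \<open>An edge is vertical iff its endpoints lie in a single column.\<close>

definition cover_of_seq ::
    "nat \<Rightarrow> (nat \<Rightarrow> nat) \<Rightarrow> (nat \<Rightarrow> nat) \<Rightarrow> (nat \<times> nat) set \<Rightarrow> nat" where
  "cover_of_seq n x h = (\<lambda>e\<in>snd (straight_snake n).
     let k = Max (snd ` e) in if snd ` e = {k} then x k - h k - h (Suc k) else h k)"

lemma cover_of_seq_vertical:
  "k \<le> n \<Longrightarrow> cover_of_seq n x h (vertical k) = x k - h k - h (Suc k)"
  using vertical_mem by (simp add: cover_of_seq_def)

lemma cover_of_seq_horizontal:
  assumes "r \<in> {1, 2}" "1 \<le> k" "k \<le> n"
  shows "cover_of_seq n x h (horizontal r k) = h k"
proof -
  have "horizontal r k \<in> snd (straight_snake n)"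
    using assms by (intro horizontal_mem)
  \<comment> \<open>A horizontal edge is indexed by its right end; \<open>1 \<le> k\<close> makes
    its two columns differ.\<close>
  moreover have "Max (snd ` horizontal r k) = k" by simp
  moreover have "snd ` horizontal r k \<noteq> {k}" using assms by auto
  ultimately show ?thesis
    unfolding cover_of_seq_def by (simp add: Let_def)
qed

lemma mem_dimer_covers_snake_iff:
  "c \<in> dimer_covers (straight_snake n) (column_label x) \<longleftrightarrow>
     c \<in> snd (straight_snake n) \<rightarrow>\<^sub>E UNIV \<and>
     (\<forall>k\<le>n. \<forall>r\<in>{1, 2}. c (vertical k) + (if k \<ge> 1 then c (horizontal r k) else 0)
        + (if k < n then c (horizontal r (Suc k)) else 0) = x k)"
proof -
  have fst: "fst (straight_snake n) = {1, 2} \<times> {0..n}"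
    by (simp add: straight_snake_def)
  have "(\<forall>v\<in>fst (straight_snake n).
          (\<Sum>e | e \<in> snd (straight_snake n) \<and> v \<in> e. c e) = column_label x v) \<longleftrightarrow>
        (\<forall>k\<le>n. \<forall>r\<in>{1, 2}. (\<Sum>e | e \<in> snd (straight_snake n) \<and> (r, k) \<in> e. c e) = x k)"
    unfolding fst column_label_def by force
  also have "\<dots> \<longleftrightarrow> (\<forall>k\<le>n. \<forall>r\<in>{1, 2}.
       c (vertical k) + (if k \<ge> 1 then c (horizontal r k) else 0)
        + (if k < n then c (horizontal r (Suc k)) else 0) = x k)"
    using sum_incident[where c = c and n = n] by simp
  finally show ?thesis by (auto simp only: dimer_covers_def mem_Collect_eq)
qed

text \<open>The two vertices of a column share the label and the vertical edge, and by induction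
  their left edges have equal multiplicity. Cancellation gives the right edges.\<close>

lemma dimer_cover_rows_eq:
  assumes c: "c \<in> dimer_covers (straight_snake n) (column_label x)" and k: "1 \<le> k" "k \<le> n"
  shows "c (horizontal 2 k) = c (horizontal 1 k)"
  using k
proof (induction k)
  case (Suc k)
  have eq: "c (vertical k) + (if k \<ge> 1 then c (horizontal r k) else 0)
      + c (horizontal r (Suc k)) = x k" if "r \<in> {1, 2}" for r
  proof -
    have k: "k \<le> n" "k < n" using Suc.prems by auto
    have "c (vertical k) + (if k \<ge> 1 then c (horizontal r k) else 0)
        + (if k < n then c (horizontal r (Suc k)) else 0) = x k"
      using c that k(1) unfolding mem_dimer_covers_snake_iff by blast
    with k(2) show ?thesis by (simp only: if_True)
  qed
  \<comment> \<open>For \<open>k = 0\<close> there are no left edges, so the argument starts here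
    without the induction hypothesis.\<close>
  show ?case
    using eq[of 1] eq[of 2] Suc by (cases "k \<ge> 1") (simp_all split: if_splits)
qed simp

text \<open>This is the condition at the bottom vertex: the default 0 of \<open>column_seq\<close>
  stands in for the edges missing at the two end columns.\<close>

lemma dimer_cover_column_sum:
  assumes "c \<in> dimer_covers (straight_snake n) (column_label x)" "k \<le> n"
  shows "c (vertical k) + column_seq n c k + column_seq n c (Suc k) = x k"
proof -
  have "c (vertical k) + (if k \<ge> 1 then c (horizontal 1 k) else 0)
      + (if k < n then c (horizontal 1 (Suc k)) else 0) = x k"
    using assms unfolding mem_dimer_covers_snake_iff by blast
  then show ?thesis using assms(2) by (simp add: column_seq_def Suc_le_eq)
qed

text \<open>A vertical multiplicity is recovered as the slack of its column, and a top one from the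
  bottom edge below it.\<close>

lemma cover_of_column_seq:
  assumes c: "c \<in> dimer_covers (straight_snake n) (column_label x)"
  shows "cover_of_seq n x (column_seq n c) = c"
proof (rule extensionalityI)
  show "cover_of_seq n x (column_seq n c) \<in> extensional (snd (straight_snake n))"
    by (simp add: cover_of_seq_def)
  show "c \<in> extensional (snd (straight_snake n))"
    using c by (auto simp: dimer_covers_def PiE_def)
  fix e assume "e \<in> snd (straight_snake n)"
  then show "cover_of_seq n x (column_seq n c) e = c e"
  proof (cases rule: straight_snake_edge_cases)
    case 1
    then show ?thesis
      using dimer_cover_column_sum[OF c 1(1)] cover_of_seq_vertical[OF 1(1)] by simp
  next
    case 2
    then show ?thesis
      using cover_of_seq_horizontal[OF 2(1-3)] dimer_cover_rows_eq[OF c 2(2,3)]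
      by (auto simp: column_seq_def)
  qed
qed

lemma cover_of_seq_mem_dimer_covers:
  assumes h: "h \<in> bounded_seqs x n 0 0"
  shows "cover_of_seq n x h \<in> dimer_covers (straight_snake n) (column_label x)"
  unfolding mem_dimer_covers_snake_iff
proof (intro conjI allI impI ballI)
  show "cover_of_seq n x h \<in> snd (straight_snake n) \<rightarrow>\<^sub>E UNIV"
    by (auto simp: cover_of_seq_def)
  fix k r :: nat assume k: "k \<le> n" and r: "r \<in> {1, 2}"
  have 1: "(if k \<ge> 1 then cover_of_seq n x h (horizontal r k) else 0) = h k"
    using cover_of_seq_horizontal[OF r _ k] h by (auto simp: bounded_seqs_def Suc_le_eq)
  have 2: "(if k < n then cover_of_seq n x h (horizontal r (Suc k)) else 0) = h (Suc k)"
    using cover_of_seq_horizontal[OF r, of "Suc k" n] h k by (auto simp: bounded_seqs_def)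
  \<comment> \<open>This makes the truncated subtraction on the vertical edge exact.\<close>
  have "h k + h (Suc k) \<le> x k"
    using h k by (auto simp: bounded_seqs_def)
  then show "cover_of_seq n x h (vertical k)
      + (if k \<ge> 1 then cover_of_seq n x h (horizontal r k) else 0)
      + (if k < n then cover_of_seq n x h (horizontal r (Suc k)) else 0) = x k"
    unfolding 1 2 cover_of_seq_vertical[OF k] by simp
qed

lemma card_dimer_covers_snake:
  "card (dimer_covers (straight_snake n) (column_label x)) = card (bounded_seqs x n 0 0)"
proof (rule bij_betw_same_card)
  show "bij_betw (column_seq n) (dimer_covers (straight_snake n) (column_label x))
      (bounded_seqs x n 0 0)"
  proof (rule bij_betw_byWitness[where f' = "cover_of_seq n x"])
    show "\<forall>h\<in>bounded_seqs x n 0 0. column_seq n (cover_of_seq n x h) = h"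
    proof (intro ballI ext)
      fix h k assume h: "h \<in> bounded_seqs x n 0 0"
      show "column_seq n (cover_of_seq n x h) k = h k"
      proof (cases "1 \<le> k \<and> k \<le> n")
        case True
        then show ?thesis
          using cover_of_seq_horizontal[of 1 k n x h] by (simp add: column_seq_def)
      next
        case False
        then consider "k = 0" | "k = Suc n" | "k > Suc n" by linarith
        then show ?thesis using False h by cases (auto simp: column_seq_def bounded_seqs_def)
      qed
    qed
    have "column_seq n c k + column_seq n c (Suc k) \<le> x k"
      if "c \<in> dimer_covers (straight_snake n) (column_label x)" "k \<le> n" for c k
      using dimer_cover_column_sum[OF that] by linarith
    then show "column_seq n ` dimer_covers (straight_snake n) (column_label x)
        \<subseteq> bounded_seqs x n 0 0"
      by (auto simp: bounded_seqs_def) (auto simp: column_seq_def)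
  qed (auto simp: cover_of_column_seq cover_of_seq_mem_dimer_covers)
qed

theorem theorem1:
  fixes n :: nat and m :: "nat \<Rightarrow> nat"
  assumes "n \<ge> 1"
  shows "(\<forall>i\<in>{1..m 0 + 1}. \<forall>j\<in>{1..m n + 1}.
            M_mat m n $$ (i - 1, j - 1) = int (card (snake_covers_ij n m i j)))
         \<and> M_mat m n $$ (0, 0) = int (card (dimer_covers (straight_snake n) (column_label m)))"
proof (intro conjI ballI)
  fix i j assume i: "i \<in> {1..m 0 + 1}" and j: "j \<in> {1..m n + 1}"
  have "M_mat m n $$ (i - 1, j - 1) = int (card (bounded_seqs m n (i - 1) (j - 1)))"
    using i j by (intro M_mat_entry) auto
  also have "card (bounded_seqs m n (i - 1) (j - 1)) =
      card (bounded_seqs (m(0 := m 0 - (i - 1), n := m n - (j - 1))) n 0 0)"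
    using i j by (intro card_bounded_seqs_boundary assms) auto
  \<comment> \<open>The shift from 0-based boundary values to 1-based indices is exact since
    \<open>i\<close> and \<open>j\<close> are at least 1.\<close>
  also have "m(0 := m 0 - (i - 1), n := m n - (j - 1)) = m(0 := m 0 + 1 - i, n := m n + 1 - j)"
    using i j by auto
  also have "card (bounded_seqs \<dots> n 0 0) = card (snake_covers_ij n m i j)"
    using i j unfolding snake_covers_ij_def card_dimer_covers_snake[symmetric] by simp
  finally show "M_mat m n $$ (i - 1, j - 1) = int (card (snake_covers_ij n m i j))" .
\<comment> \<open>For the corner entry both boundary values are already 0, so the labels stay
  unchanged.\<close>
qed (simp add: M_mat_entry card_dimer_covers_snake)

end
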